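(* Let $\mathbb{K}$ be an algebraically closed field of characteristic zero, let $A$ be a unital commutative associative algebra over $\mathbb{K}$, and let $\mathfrak{g}$ be a Leibniz algebra over $\mathbb{K}$ such that $\gamma_2^{\mathrm{Lie}}(\mathfrak{g})\neq 0$ and $\Gamma^{\mathrm{Lie}}(\mathfrak{g})=\mathbb{K}\cdot\mathrm{Id}$. Then $\Gamma^{\mathrm{Lie}}(A\otimes\mathfrak{g})=\Gamma(A)\otimes\Gamma^{\mathrm{Lie}}(\mathfrak{g})\cong A$.
   Context: Vector spaces and tensor products are over $\mathbb{K}$. A Leibniz algebra is a vector space $\mathfrak{g}$ with a bilinear map $[-,-]:\mathfrak{g}\times\mathfrak{g}\to\mathfrak{g}$ satisfying $[x,[y,z]]=[[x,y],z]-[[x,z],y]$ for all $x,y,z\in\mathfrak g$. Put $[x,y]_{\mathrm{Lie}}=[x,y]+[y,x]$. $\gamma_2^{\mathrm{Lie}}(\mathfrak{g})=[\mathfrak g,\mathfrak g]_{\mathrm{Lie}}$ is the two-sided ideal of $\mathfrak g$ generated by all $[x,y]_{\mathrm{Lie}}$, $x,y\in\mathfrak{g}$. The Lie-centroid $\Gamma^{\mathrm{Lie}}(\mathfrak{g})$ is the set of linear maps $d:\mathfrak{g}\to\mathfrak{g}$ with $d([x,y]_{\mathrm{Lie}})=[d(x),y]_{\mathrm{Lie}}=[x,d(y)]_{\mathrm{Lie}}$ for all $x,y\in\mathfrak g$; it is a subalgebra of $\mathrm{End}_{\mathbb K}(\mathfrak g)$. The centroid of $A$ is $\Gamma(A)=\{f\in\mathrm{End}_{\mathbb{K}}(A)\mid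 f(ab)=f(a)b=af(b)\text{ for all }a,b\in A\}$. $A\otimes\mathfrak{g}$ is a Leibniz algebra with $[a_1\otimes g_1,a_2\otimes g_2]=(a_1a_2)\otimes[g_1,g_2]$. An element $f\otimes\varphi$ with $f\in\mathrm{End}_{\mathbb{K}}(A)$, $\varphi\in\mathrm{End}_{\mathbb{K}}(\mathfrak{g})$ is identified with the endomorphism of $A\otimes\mathfrak{g}$ given by $a\otimes g\mapsto f(a)\otimes\varphi(g)$, so $\Gamma(A)\otimes\Gamma^{\mathrm{Lie}}(\mathfrak{g})$ is regarded as the span of such endomorphisms inside $\mathrm{End}_{\mathbb{K}}(A\otimes\mathfrak{g})$. *)

theory Defs
  imports "HOL-Computational_Algebra.Polynomial" "HOL-Library.Poly_Mapping"
    "HOL-Library.Function_Algebras"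
begin

section \<open>Algebras\<close>

text \<open>The class \<open>comm_ring\<close> has no unit and hence does not force \<open>0 \<noteq> 1\<close>; with the unit as an
  explicit parameter, the zero algebra is included.\<close>

locale unital_comm_algebra = vector_space scale
  for scale :: "'k::field \<Rightarrow> 'a::comm_ring \<Rightarrow> 'a" +
  fixes unit :: 'a
  assumes scale_mult: "scale c (a * b) = scale c a * b"
    and unit_mult: "unit * a = a"

definition centroid :: "('k::field \<Rightarrow> 'a::comm_ring \<Rightarrow> 'a) \<Rightarrow> ('a \<Rightarrow> 'a) set" where
  "centroid scale =
     {f. Vector_Spaces.linear scale scale f \<and> (\<forall>a b. f (a * b) = f a * b \<and> f (a * b) = a * f b)}"

definition bilinear_map ::
  "('k::field \<Rightarrow> 'u::ab_group_add \<Rightarrow> 'u) \<Rightarrow> ('k \<Rightarrow> 'v::ab_group_add \<Rightarrow> 'v) \<Rightarrow>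
   ('k \<Rightarrow> 'w::ab_group_add \<Rightarrow> 'w) \<Rightarrow> ('u \<Rightarrow> 'v \<Rightarrow> 'w) \<Rightarrow> bool" where
  "bilinear_map s1 s2 s3 f \<longleftrightarrow>
     (\<forall>y. Vector_Spaces.linear s1 s3 (\<lambda>x. f x y)) \<and> (\<forall>x. Vector_Spaces.linear s2 s3 (\<lambda>y. f x y))"

text \<open>Right Leibniz algebras.\<close>

locale leibniz_algebra = vector_space scale
  for scale :: "'k::field \<Rightarrow> 'g::ab_group_add \<Rightarrow> 'g" +
  fixes bracket :: "'g \<Rightarrow> 'g \<Rightarrow> 'g"
  assumes bilinear: "bilinear_map scale scale scale bracket"
    and leibniz: "bracket x (bracket y z) = bracket (bracket x y) z - bracket (bracket x z) y"

definition Lie_bracket :: "('g::ab_group_add \<Rightarrow> 'g \<Rightarrow> 'g) \<Rightarrow> 'g \<Rightarrow> 'g \<Rightarrow> 'g" where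
  "Lie_bracket bracket x y = bracket x y + bracket y x"

definition two_sided_ideal ::
  "('k::field \<Rightarrow> 'g::ab_group_add \<Rightarrow> 'g) \<Rightarrow> ('g \<Rightarrow> 'g \<Rightarrow> 'g) \<Rightarrow> 'g set \<Rightarrow> bool" where
  "two_sided_ideal scale bracket I \<longleftrightarrow>
     module.subspace scale I \<and> (\<forall>x\<in>I. \<forall>y. bracket x y \<in> I \<and> bracket y x \<in> I)"

definition gamma2_Lie ::
  "('k::field \<Rightarrow> 'g::ab_group_add \<Rightarrow> 'g) \<Rightarrow> ('g \<Rightarrow> 'g \<Rightarrow> 'g) \<Rightarrow> 'g set" where
  "gamma2_Lie scale bracket =
     two_sided_ideal scale bracket hull {Lie_bracket bracket x y | x y. True}"

definition Lie_centroid ::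
  "('k::field \<Rightarrow> 'g::ab_group_add \<Rightarrow> 'g) \<Rightarrow> ('g \<Rightarrow> 'g \<Rightarrow> 'g) \<Rightarrow> ('g \<Rightarrow> 'g) set" where
  "Lie_centroid scale bracket =
     {d. Vector_Spaces.linear scale scale d \<and>
         (\<forall>x y. d (Lie_bracket bracket x y) = Lie_bracket bracket (d x) y \<and>
                d (Lie_bracket bracket x y) = Lie_bracket bracket x (d y))}"


section \<open>Tensor products of vector spaces\<close>

text \<open>\<open>'x \<Rightarrow>\<^sub>0 'k\<close> is the free vector space on \<open>'x\<close>, with basis vectors \<open>single x 1\<close>.\<close>

definition free_scale :: "'k::field \<Rightarrow> ('x \<Rightarrow>\<^sub>0 'k) \<Rightarrow> ('x \<Rightarrow>\<^sub>0 'k)" where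
  "free_scale c p = Poly_Mapping.map ((*) c) p"

definition free_extend ::
  "('k::field \<Rightarrow> 'w::ab_group_add \<Rightarrow> 'w) \<Rightarrow> ('x \<Rightarrow> 'w) \<Rightarrow> ('x \<Rightarrow>\<^sub>0 'k) \<Rightarrow> 'w" where
  "free_extend scale f p =
     (\<Sum>x\<in>Poly_Mapping.keys p. scale (Poly_Mapping.lookup p x) (f x))"

definition tensor_relations ::
  "('k::field \<Rightarrow> 'u::ab_group_add \<Rightarrow> 'u) \<Rightarrow> ('k \<Rightarrow> 'v::ab_group_add \<Rightarrow> 'v) \<Rightarrow>
   ('u \<times> 'v \<Rightarrow>\<^sub>0 'k) set" where
  "tensor_relations sU sV =
     {Poly_Mapping.single (u + u', v) 1 - Poly_Mapping.single (u, v) 1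
        - Poly_Mapping.single (u', v) 1 | u u' v. True} \<union>
     {Poly_Mapping.single (u, v + v') 1 - Poly_Mapping.single (u, v) 1
        - Poly_Mapping.single (u, v') 1 | u v v'. True} \<union>
     {Poly_Mapping.single (sU c u, v) 1 - Poly_Mapping.single (u, v) c | c u v. True} \<union>
     {Poly_Mapping.single (u, sV c v) 1 - Poly_Mapping.single (u, v) c | c u v. True}"

text \<open>The quotient of the free vector space on \<open>U \<times> V\<close> by the bilinearity relations depends on the
  scalar multiplications, which are terms, so it is not the value of a type constructor. Instead,
  \<open>T\<close> with \<open>tens\<close> is a tensor product if the linear extension of \<open>(u, v) \<mapsto> tens u v\<close> to the
  free vector space identifies \<open>T\<close> with this quotient. The usual universal property, for target
  spaces of any type, is \<open>universal\<close> below.\<close>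

locale tensor_product =
  U: vector_space sU + V: vector_space sV + T: vector_space sT
  for sU :: "'k::field \<Rightarrow> 'u::ab_group_add \<Rightarrow> 'u"
    and sV :: "'k \<Rightarrow> 'v::ab_group_add \<Rightarrow> 'v"
    and sT :: "'k \<Rightarrow> 't::ab_group_add \<Rightarrow> 't" +
  fixes tens :: "'u \<Rightarrow> 'v \<Rightarrow> 't"
  assumes surj: "surj (free_extend sT (\<lambda>(u, v). tens u v))"
    and kernel: "{p. free_extend sT (\<lambda>(u, v). tens u v) p = 0} =
                 module.span free_scale (tensor_relations sU sV)"

text \<open>The endomorphism \<open>f \<otimes> \<phi>\<close>; see \<open>tensor_map\<close> below for its existence.\<close>

definition tensor_End ::
  "('k::field \<Rightarrow> 't::ab_group_add \<Rightarrow> 't) \<Rightarrow> ('u \<Rightarrow> 'v \<Rightarrow> 't) \<Rightarrow>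
   ('u \<Rightarrow> 'u) \<Rightarrow> ('v \<Rightarrow> 'v) \<Rightarrow> ('t \<Rightarrow> 't)" where
  "tensor_End sT tens f \<phi> =
     (THE h. Vector_Spaces.linear sT sT h \<and> (\<forall>u v. h (tens u v) = tens (f u) (\<phi> v)))"

definition End_scale :: "('k \<Rightarrow> 't \<Rightarrow> 't) \<Rightarrow> 'k \<Rightarrow> ('t \<Rightarrow> 't) \<Rightarrow> ('t \<Rightarrow> 't)" where
  "End_scale sT c h = (\<lambda>z. sT c (h z))"

text \<open>Addition of endomorphisms is the pointwise addition of \<open>Function_Algebras\<close>.\<close>

definition tensor_End_span ::
  "('k::field \<Rightarrow> 't::ab_group_add \<Rightarrow> 't) \<Rightarrow> ('u \<Rightarrow> 'v \<Rightarrow> 't) \<Rightarrow>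
   ('u \<Rightarrow> 'u) set \<Rightarrow> ('v \<Rightarrow> 'v) set \<Rightarrow> ('t \<Rightarrow> 't) set" where
  "tensor_End_span sT tens F G =
     module.span (End_scale sT) {tensor_End sT tens f \<phi> | f \<phi>. f \<in> F \<and> \<phi> \<in> G}"

text \<open>The bracket of \<open>A \<otimes> \<gg>\<close>; see \<open>tensor_bracket\<close> below for its existence.\<close>

definition tensor_bracket ::
  "('k::field \<Rightarrow> 't::ab_group_add \<Rightarrow> 't) \<Rightarrow> ('a::comm_ring \<Rightarrow> 'g \<Rightarrow> 't) \<Rightarrow>
   ('g \<Rightarrow> 'g \<Rightarrow> 'g) \<Rightarrow> 't \<Rightarrow> 't \<Rightarrow> 't" where
  "tensor_bracket sT tens bracket =
     (THE B. bilinear_map sT sT sT B \<and>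
             (\<forall>a x b y. B (tens a x) (tens b y) = tens (a * b) (bracket x y)))"


section \<open>Well-definedness\<close>

lemma vector_space_End_scale:
  assumes "vector_space sT"
  shows "vector_space (End_scale sT)"
proof -
  interpret vector_space sT by fact
  show ?thesis
    by unfold_locales (auto simp: End_scale_def fun_eq_iff algebra_simps)
qed

lemma lookup_free_scale [simp]:
  "Poly_Mapping.lookup (free_scale c p) x = c * Poly_Mapping.lookup p x"
  by (simp add: free_scale_def Poly_Mapping.map.rep_eq when_def)

lemma vector_space_free_scale: "vector_space free_scale"
  by unfold_locales (auto intro!: poly_mapping_eqI simp: lookup_add algebra_simps)

lemma free_extend_superset:
  assumes "vector_space s" "finite S" "Poly_Mapping.keys p \<subseteq> S"
  shows "free_extend s f p = (\<Sum>x\<in>S. s (Poly_Mapping.lookup p x) (f x))"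
proof -
  interpret vector_space s by fact
  show ?thesis
    unfolding free_extend_def
    by (rule sum.mono_neutral_left) (use assms in \<open>auto simp: in_keys_iff\<close>)
qed

lemma linear_free_extend:
  fixes s :: "'k::field \<Rightarrow> 'w::ab_group_add \<Rightarrow> 'w" and f :: "'x \<Rightarrow> 'w"
  assumes "vector_space s"
  shows "Vector_Spaces.linear free_scale s (free_extend s f)"
proof -
  interpret vector_space s by fact
  show ?thesis
    unfolding Vector_Spaces.linear_iff
  proof (intro conjI allI)
    fix p q :: "'x \<Rightarrow>\<^sub>0 'k" and c :: 'k
    let ?S = "Poly_Mapping.keys p \<union> Poly_Mapping.keys q"
    have "free_extend s f (p + q) = (\<Sum>x\<in>?S. s (Poly_Mapping.lookup (p + q) x) (f x))"
      using Poly_Mapping.keys_add[of p q] by (intro free_extend_superset assms) auto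
    also have "\<dots> = free_extend s f p + free_extend s f q"
      by (simp add: free_extend_superset[OF assms, of ?S] lookup_add algebra_simps sum.distrib)
    finally show "free_extend s f (p + q) = free_extend s f p + free_extend s f q" .
    have "free_extend s f (free_scale c p) =
        (\<Sum>x\<in>Poly_Mapping.keys p. s (Poly_Mapping.lookup (free_scale c p) x) (f x))"
      by (intro free_extend_superset assms) (auto simp: in_keys_iff)
    then show "free_extend s f (free_scale c p) = s c (free_extend s f p)"
      by (simp add: free_extend_def scale_sum_right)
  qed (use assms vector_space_free_scale in auto)
qed

lemma free_extend_single:
  assumes "vector_space s"
  shows "free_extend s f (Poly_Mapping.single x c) = s c (f x)"
  using free_extend_superset[OF assms, of "{x}" "Poly_Mapping.single x c" f]
  by simp

lemma linear_diff':
  assumes "Vector_Spaces.linear s1 s2 f"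
  shows "f (x - y) = f x - f y"
proof -
  have "f ((x - y) + y) = f (x - y) + f y"
    using assms unfolding Vector_Spaces.linear_iff by blast
  then show ?thesis
    by (simp add: algebra_simps)
qed

lemma linear_zero':
  assumes "Vector_Spaces.linear s1 s2 f"
  shows "f 0 = 0"
  using linear_diff'[OF assms, of 0 0] by simp

context tensor_product
begin

lemmas linear_tens = linear_free_extend[OF T.vector_space_axioms, of "\<lambda>(u, v). tens u v"]

lemma relation_kernel:
  assumes "p \<in> tensor_relations sU sV"
  shows "free_extend sT (\<lambda>(u, v). tens u v) p = 0"
proof -
  interpret F: vector_space "free_scale :: 'k \<Rightarrow> ('u \<times> 'v \<Rightarrow>\<^sub>0 'k) \<Rightarrow> _"
    by (rule vector_space_free_scale)
  show ?thesis
    using kernel F.span_base[OF assms] by auto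
qed

lemma bilinear_tens: "bilinear_map sU sV sT tens"
proof -
  note s = linear_diff'[OF linear_tens] free_extend_single[OF T.vector_space_axioms]
  have "Poly_Mapping.single (u + u', v) 1 - Poly_Mapping.single (u, v) 1
      - Poly_Mapping.single (u', v) 1 \<in> tensor_relations sU sV" for u u' v
    unfolding tensor_relations_def by blast
  from relation_kernel[OF this, unfolded s] have "tens (u + u') v = tens u v + tens u' v" for u u' v
    by (simp add: algebra_simps)
  moreover have "Poly_Mapping.single (u, v + v') 1 - Poly_Mapping.single (u, v) 1
      - Poly_Mapping.single (u, v') 1 \<in> tensor_relations sU sV" for u v v'
    unfolding tensor_relations_def by blast
  from relation_kernel[OF this, unfolded s] have "tens u (v + v') = tens u v + tens u v'" for u v v'
    by (simp add: algebra_simps)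
  moreover have "Poly_Mapping.single (sU c u, v) 1 - Poly_Mapping.single (u, v) c
      \<in> tensor_relations sU sV" for c u v
    unfolding tensor_relations_def by blast
  from relation_kernel[OF this, unfolded s] have "tens (sU c u) v = sT c (tens u v)" for c u v
    by simp
  moreover have "Poly_Mapping.single (u, sV c v) 1 - Poly_Mapping.single (u, v) c
      \<in> tensor_relations sU sV" for c u v
    unfolding tensor_relations_def by blast
  from relation_kernel[OF this, unfolded s] have "tens u (sV c v) = sT c (tens u v)" for c u v
    by simp
  ultimately show ?thesis
    unfolding bilinear_map_def Vector_Spaces.linear_iff
    using U.vector_space_axioms V.vector_space_axioms T.vector_space_axioms by blast
qed

lemma tensor_induct [case_names tens add scale]:
  assumes tens: "\<And>u v. P (tens u v)"
    and add: "\<And>z w. P z \<Longrightarrow> P w \<Longrightarrow> P (z + w)"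
    and scale: "\<And>c z. P z \<Longrightarrow> P (sT c z)"
  shows "P z"
proof -
  obtain p where z: "z = free_extend sT (\<lambda>(u, v). tens u v) p"
    using surj by (meson surjD)
  have 0: "P 0"
    using scale[OF tens[of 0 0], of 0] by simp
  have "P (\<Sum>x\<in>S. sT (Poly_Mapping.lookup p x) (case x of (u, v) \<Rightarrow> tens u v))"
    if "finite S" for S
    using that by induction (auto intro!: 0 add scale tens)
  then show ?thesis
    by (simp add: z free_extend_def)
qed

lemma linear_eqI:
  assumes "Vector_Spaces.linear sT sW h" "Vector_Spaces.linear sT sW h'" "\<And>u v. h (tens u v) = h' (tens u v)"
  shows "h = h'"
proof
  fix z
  show "h z = h' z"
    by (induction z rule: tensor_induct) (use assms in \<open>auto simp: Vector_Spaces.linear_iff\<close>)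
qed

theorem universal:
  assumes \<beta>: "bilinear_map sU sV sW \<beta>"
  shows "\<exists>!h. Vector_Spaces.linear sT sW h \<and> (\<forall>u v. h (tens u v) = \<beta> u v)"
proof (rule ex_ex1I)
  have W: "vector_space sW"
    using \<beta> by (auto simp: bilinear_map_def Vector_Spaces.linear_iff)
  interpret W: vector_space sW by (rule W)
  interpret F: vector_space "free_scale :: 'k \<Rightarrow> ('u \<times> 'v \<Rightarrow>\<^sub>0 'k) \<Rightarrow> _"
    by (rule vector_space_free_scale)
  let ?t = "free_extend sT (\<lambda>(u, v). tens u v)"
  let ?b = "free_extend sW (\<lambda>(u, v). \<beta> u v)"
  have lb: "Vector_Spaces.linear free_scale sW ?b"
    by (rule linear_free_extend[OF W])
  have \<beta>_lin: "\<beta> (u + u') v = \<beta> u v + \<beta> u' v" "\<beta> (sU c u) v = sW c (\<beta> u v)"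
    "\<beta> u (v + v') = \<beta> u v + \<beta> u v'" "\<beta> u (sV c v) = sW c (\<beta> u v)" for u u' v v' c
    using \<beta> by (auto simp: bilinear_map_def Vector_Spaces.linear_iff)
  have rel: "?b p = 0" if "p \<in> tensor_relations sU sV" for p
    using that unfolding tensor_relations_def
    by (auto simp: linear_diff'[OF lb] free_extend_single[OF W] \<beta>_lin)
  have "?b p = 0" if "p \<in> F.span (tensor_relations sU sV)" for p
    using that
  proof (induction p rule: F.span_induct_alt)
    case base
    show ?case
      by (rule linear_zero'[OF lb])
  next
    case (step c x y)
    then show ?case
      using lb rel by (simp add: Vector_Spaces.linear_iff)
  qed
  then have ker: "?b p = 0" if "?t p = 0" for p
    using that kernel by auto
  have eq: "?b p = ?b q" if "?t p = ?t q" for p q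
    using ker[of "p - q"] that by (simp add: linear_diff'[OF lb] linear_diff'[OF linear_tens])
  define h where "h z = ?b (inv ?t z)" for z
  have h: "h (?t p) = ?b p" for p
    unfolding h_def by (rule eq) (simp add: surj surj_f_inv_f)
  have "Vector_Spaces.linear sT sW h"
    unfolding Vector_Spaces.linear_iff
  proof (intro conjI allI)
    fix z w :: 't and c
    obtain p q where pq: "z = ?t p" "w = ?t q"
      using surj by (meson surjD)
    have "z + w = ?t (p + q)" "sT c z = ?t (free_scale c p)"
      using linear_tens unfolding pq by (simp_all add: Vector_Spaces.linear_iff)
    then show "h (z + w) = h z + h w" "h (sT c z) = sW c (h z)"
      using lb unfolding Vector_Spaces.linear_iff by (simp_all add: h pq)
  qed (rule T.vector_space_axioms W)+
  moreover have "h (tens u v) = \<beta> u v" for u v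
    using h[of "Poly_Mapping.single (u, v) 1"]
    by (simp add: free_extend_single[OF W] free_extend_single[OF T.vector_space_axioms])
  ultimately show "\<exists>h. Vector_Spaces.linear sT sW h \<and> (\<forall>u v. h (tens u v) = \<beta> u v)"
    by blast
next
  fix h h'
  assume "Vector_Spaces.linear sT sW h \<and> (\<forall>u v. h (tens u v) = \<beta> u v)"
    "Vector_Spaces.linear sT sW h' \<and> (\<forall>u v. h' (tens u v) = \<beta> u v)"
  then show "h = h'"
    by (intro linear_eqI) auto
qed

lemma tensor_map:
  assumes "Vector_Spaces.linear sU sU f" "Vector_Spaces.linear sV sV \<phi>"
  shows "Vector_Spaces.linear sT sT (tensor_End sT tens f \<phi>)"
    and "tensor_End sT tens f \<phi> (tens u v) = tens (f u) (\<phi> v)"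
proof -
  have "bilinear_map sU sV sT (\<lambda>u v. tens (f u) (\<phi> v))"
    using assms bilinear_tens by (auto simp: bilinear_map_def Vector_Spaces.linear_iff)
  from theI'[OF universal[OF this]]
  show "Vector_Spaces.linear sT sT (tensor_End sT tens f \<phi>)"
    and "tensor_End sT tens f \<phi> (tens u v) = tens (f u) (\<phi> v)"
    unfolding tensor_End_def by auto
qed

end

lemma tensor_bracket_ex1:
  fixes sA :: "'k::field \<Rightarrow> 'a::comm_ring \<Rightarrow> 'a"
  assumes "unital_comm_algebra sA e" "leibniz_algebra sG bracket"
    and "tensor_product sA sG sT tens"
  shows "\<exists>!B. bilinear_map sT sT sT B \<and>
           (\<forall>a x b y. B (tens a x) (tens b y) = tens (a * b) (bracket x y))"
proof -
  interpret A: unital_comm_algebra sA e by fact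
  interpret G: leibniz_algebra sG bracket by fact
  interpret tensor_product sA sG sT tens by fact
  have scale_mult': "sA c (a * b) = a * sA c b" for c a b
    using A.scale_mult[of c b a] by (simp add: mult.commute)
  have 1: "bilinear_map sA sG sT (\<lambda>a x. tens (a * b) (bracket x y))" for b y
    using bilinear_tens G.bilinear
    by (auto simp: bilinear_map_def Vector_Spaces.linear_iff distrib_right A.scale_mult[symmetric])
  define R where "R b y = (THE h. Vector_Spaces.linear sT sT h \<and>
      (\<forall>a x. h (tens a x) = tens (a * b) (bracket x y)))" for b y
  have linR: "Vector_Spaces.linear sT sT (R b y)" and R: "R b y (tens a x) = tens (a * b) (bracket x y)"
    for a b x y
    using theI'[OF universal[OF 1[of b y]]] unfolding R_def by auto
  have Rlin: "R b y (z + w) = R b y z + R b y w" "R b y (sT c z) = sT c (R b y z)" for b y z w c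
    using linR by (auto simp: Vector_Spaces.linear_iff)
  have Radd1: "R (b + b') y z = R b y z + R b' y z" for b b' y z
    by (induction z rule: tensor_induct)
      (use bilinear_tens in \<open>auto simp: bilinear_map_def Vector_Spaces.linear_iff R Rlin distrib_left algebra_simps\<close>)
  have Radd2: "R b (y + y') z = R b y z + R b y' z" for b y y' z
    by (induction z rule: tensor_induct)
      (use bilinear_tens G.bilinear in \<open>auto simp: bilinear_map_def Vector_Spaces.linear_iff R Rlin algebra_simps\<close>)
  have Rsc1: "R (sA c b) y z = sT c (R b y z)" for c b y z
    by (induction z rule: tensor_induct)
      (use bilinear_tens in \<open>auto simp: bilinear_map_def Vector_Spaces.linear_iff R Rlin algebra_simps
          scale_mult'[symmetric]\<close>)
  have Rsc2: "R b (sG c y) z = sT c (R b y z)" for c b y z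
    by (induction z rule: tensor_induct)
      (use bilinear_tens G.bilinear in \<open>auto simp: bilinear_map_def Vector_Spaces.linear_iff R Rlin algebra_simps\<close>)
  have 2: "bilinear_map sA sG sT (\<lambda>b y. R b y z)" for z
    by (auto simp: bilinear_map_def Vector_Spaces.linear_iff Radd1 Radd2 Rsc1 Rsc2 A.vector_space_axioms
        G.vector_space_axioms T.vector_space_axioms)
  define B where "B z = (THE h. Vector_Spaces.linear sT sT h \<and> (\<forall>b y. h (tens b y) = R b y z))" for z
  have linB: "Vector_Spaces.linear sT sT (B z)" and B: "B z (tens b y) = R b y z" for z b y
    using theI'[OF universal[OF 2[of z]]] unfolding B_def by auto
  have Blin: "B u (z + w) = B u z + B u w" "B u (sT c z) = sT c (B u z)" for u z w c
    using linB by (auto simp: Vector_Spaces.linear_iff)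
  have "B (z + w) u = B z u + B w u" "B (sT c z) u = sT c (B z u)" for z w u c
    by (induction u rule: tensor_induct) (auto simp: B Rlin Blin algebra_simps)
  then have "bilinear_map sT sT sT B"
    using linB by (auto simp: bilinear_map_def Vector_Spaces.linear_iff)
  moreover have "B (tens a x) (tens b y) = tens (a * b) (bracket x y)" for a b x y
    by (simp add: B R)
  ultimately have ex: "bilinear_map sT sT sT B \<and>
      (\<forall>a x b y. B (tens a x) (tens b y) = tens (a * b) (bracket x y))"
    by blast
  show ?thesis
  proof (rule ex1I, rule ex)
    fix C
    assume C: "bilinear_map sT sT sT C \<and>
      (\<forall>a x b y. C (tens a x) (tens b y) = tens (a * b) (bracket x y))"
    have *: "C (tens a x) = B (tens a x)" for a x
      by (rule linear_eqI[of sT]) (use C ex in \<open>auto simp: bilinear_map_def\<close>)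
    have "(\<lambda>z. C z w) = (\<lambda>z. B z w)" for w
      by (rule linear_eqI[of sT]) (use C ex * in \<open>auto simp: bilinear_map_def\<close>)
    then show "C = B"
      by (simp add: fun_eq_iff)
  qed
qed

lemma tensor_bracket:
  fixes sA :: "'k::field \<Rightarrow> 'a::comm_ring \<Rightarrow> 'a"
  assumes "unital_comm_algebra sA e" "leibniz_algebra sG bracket"
    and "tensor_product sA sG sT tens"
  shows "bilinear_map sT sT sT (tensor_bracket sT tens bracket)"
    and "tensor_bracket sT tens bracket (tens a x) (tens b y) = tens (a * b) (bracket x y)"
  using theI'[OF tensor_bracket_ex1[OF assms]] unfolding tensor_bracket_def by auto

theorem leibniz_algebra_tensor:
  fixes sA :: "'k::field \<Rightarrow> 'a::comm_ring \<Rightarrow> 'a"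
  assumes "unital_comm_algebra sA e" "leibniz_algebra sG bracket"
    and "tensor_product sA sG sT tens"
  shows "leibniz_algebra sT (tensor_bracket sT tens bracket)"
proof -
  interpret G: leibniz_algebra sG bracket by fact
  interpret tensor_product sA sG sT tens by fact
  let ?B = "tensor_bracket sT tens bracket"
  note tb = tensor_bracket[OF assms]
  have lin: "?B (u + v) w = ?B u w + ?B v w" "?B (sT c u) w = sT c (?B u w)"
    "?B w (u + v) = ?B w u + ?B w v" "?B w (sT c u) = sT c (?B w u)" for u v w c
    using tb(1) by (auto simp: bilinear_map_def Vector_Spaces.linear_iff)
  have td: "tens a (x - y) = tens a x - tens a y" for a x y
    using bilinear_tens by (auto simp: bilinear_map_def intro: linear_diff')
  have "?B z (?B v w) = ?B (?B z v) w - ?B (?B z w) v" for z v w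
  proof (induction z rule: tensor_induct)
    case (tens a x)
    show ?case
    proof (induction v rule: tensor_induct)
      case (tens b y)
      show ?case
      proof (induction w rule: tensor_induct)
        case (tens c u)
        have "a * c * b = a * b * c"
          by (simp add: mult_ac)
        then show ?case
          by (simp add: tb(2) td G.leibniz[of x y u] mult.assoc)
      qed (simp_all add: lin add_diff_add T.scale_right_diff_distrib)
    qed (simp_all add: lin add_diff_add T.scale_right_diff_distrib)
  qed (simp_all add: lin add_diff_add T.scale_right_diff_distrib)
  then show ?thesis
    by unfold_locales (rule tb(1))
qed

end

theory Submission
  imports Defs
begin

text \<open>Contracting the first tensor factor with a linear functional \<open>\<alpha>\<close> on \<open>A\<close> turns
  \<open>x \<mapsto> d (a \<otimes> x)\<close>, for \<open>d\<close> in the Lie-centroid of \<open>A \<otimes> \<gg>\<close>, into an element of the Lie-centroid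
  of \<open>\<gg>\<close>, that is, into a scalar. As this holds for all \<open>\<alpha>\<close>, we get \<open>d (a \<otimes> x) = \<rho> a \<otimes> x\<close> for
  some \<open>\<rho>\<close>. Evaluating \<open>d\<close> on \<open>[1 \<otimes> x, a \<otimes> y]\<close> with \<open>[x, y] + [y, x] \<noteq> 0\<close> shows that
  \<open>\<rho>\<close> is multiplication by \<open>\<rho> 1\<close>.\<close>

section \<open>Coordinate functionals of a vector space\<close>

lemma (in vector_space) basis_coordinates_linear:
  assumes "independent B" "span B = UNIV"
  shows "Vector_Spaces.linear scale (*) (\<lambda>x. representation B x b)"
proof -
  interpret K: vector_space "(*) :: 'a \<Rightarrow> 'a \<Rightarrow> 'a"
    by unfold_locales (auto simp: algebra_simps)
  show ?thesis
    using assms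
    by (simp add: Vector_Spaces.linear_iff representation_add representation_scale
        vector_space_axioms K.vector_space_axioms)
qed

text \<open>A nonzero \<open>x\<close> extends to a basis, and its own coordinate in that basis is
  the functional.\<close>

lemma (in vector_space) functional_eq_1_exists:
  assumes "x \<noteq> 0"
  obtains \<phi> where "Vector_Spaces.linear scale (*) \<phi>" "\<phi> x = 1"
proof -
  let ?B = "extend_basis {x}"
  have ind: "independent {x}"
    using assms by simp
  have x: "x \<in> ?B"
    using extend_basis_superset[OF ind] by simp
  show ?thesis
    using that[OF basis_coordinates_linear[OF independent_extend_basis[OF ind]
        span_extend_basis[OF ind], of x]]
      representation_basis[OF independent_extend_basis[OF ind] x] by simp
qed

section \<open>Contraction of one tensor factor\<close>

context tensor_product
begin

lemma tens_simps:
  "tens (u + u') v = tens u v + tens u' v"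
  "tens u (v + v') = tens u v + tens u v'"
  "tens (sU c u) v = sT c (tens u v)"
  "tens u (sV c v) = sT c (tens u v)"
  using bilinear_tens by (auto simp: bilinear_map_def Vector_Spaces.linear_iff)

lemma tens_zero_left: "tens 0 v = 0"
  using tens_simps(1)[of 0 0 v] by simp

lemma tens_sum_left: "tens (\<Sum>i\<in>I. f i) v = (\<Sum>i\<in>I. tens (f i) v)"
  by (induction I rule: infinite_finite_induct) (simp_all add: tens_zero_left tens_simps)

text \<open>The map is \<open>\<alpha> \<otimes> id\<close> followed by the identification of the
  field tensored with \<open>V\<close> and \<open>V\<close> itself.\<close>

lemma contract_left:
  assumes "Vector_Spaces.linear sU (*) \<alpha>"
  obtains h where "Vector_Spaces.linear sT sV h" "\<And>u v. h (tens u v) = sV (\<alpha> u) v"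
proof -
  have "bilinear_map sU sV sV (\<lambda>u v. sV (\<alpha> u) v)"
    using assms U.vector_space_axioms V.vector_space_axioms
    by (auto simp: bilinear_map_def Vector_Spaces.linear_iff V.scale_left_distrib
        V.scale_right_distrib mult.commute)
  from universal[OF this] show ?thesis
    using that by blast
qed

lemma contract_right:
  assumes "Vector_Spaces.linear sV (*) \<phi>"
  obtains h where "Vector_Spaces.linear sT sU h" "\<And>u v. h (tens u v) = sU (\<phi> v) u"
proof -
  have "bilinear_map sU sV sU (\<lambda>u v. sU (\<phi> v) u)"
    using assms U.vector_space_axioms V.vector_space_axioms
    by (auto simp: bilinear_map_def Vector_Spaces.linear_iff U.scale_left_distrib
        U.scale_right_distrib mult.commute)
  from universal[OF this] show ?thesis
    using that by blast
qed

text \<open>Contracting the right factor with a functional that is 1 at \<open>v\<close> recovers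
  \<open>u\<close> from \<open>tens u v\<close>.\<close>

lemma tens_left_cancel:
  assumes "v \<noteq> 0" "tens u v = tens u' v"
  shows "u = u'"
proof -
  obtain \<phi> where \<phi>: "Vector_Spaces.linear sV (*) \<phi>" "\<phi> v = 1"
    using V.functional_eq_1_exists[OF assms(1)] .
  obtain h where "\<And>u v. h (tens u v) = sU (\<phi> v) u"
    using contract_right[OF \<phi>(1)] by blast
  then have "sU (\<phi> v) u = sU (\<phi> v) u'"
    using assms(2) by metis
  then show ?thesis
    by (simp add: \<phi>(2))
qed

text \<open>For a basis \<open>B\<close> of the left factor, every \<open>z\<close> is a finite sum
  of terms \<open>tens b (h b z)\<close>, where \<open>h b\<close> contracts with the coordinate
  functional at \<open>b\<close>. Hence these contractions determine \<open>z\<close>.\<close>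

lemma eq_if_contractions_eq:
  assumes "\<And>\<alpha> h. Vector_Spaces.linear sU (*) \<alpha> \<Longrightarrow> Vector_Spaces.linear sT sV h \<Longrightarrow>
      (\<And>u v. h (tens u v) = sV (\<alpha> u) v) \<Longrightarrow> h z = h w"
  shows "z = w"
proof -
  define B where "B = U.extend_basis {}"
  have B: "U.independent B" "U.span B = UNIV"
    unfolding B_def
    by (simp_all add: U.independent_extend_basis U.span_extend_basis U.independent_empty)
  define \<alpha> where "\<alpha> b u = U.representation B u b" for b u
  have \<alpha>: "Vector_Spaces.linear sU (*) (\<alpha> b)" for b
    unfolding \<alpha>_def by (rule U.basis_coordinates_linear[OF B])
  have "\<forall>b. \<exists>h. Vector_Spaces.linear sT sV h \<and> (\<forall>u v. h (tens u v) = sV (\<alpha> b u) v)"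
    using contract_left[OF \<alpha>] by metis
  then obtain h where lin: "\<And>b. Vector_Spaces.linear sT sV (h b)"
    and h: "\<And>b u v. h b (tens u v) = sV (\<alpha> b u) v"
    by metis
  have hs: "h b (x + y) = h b x + h b y" "h b (sT c x) = sV c (h b x)" for b c x y
    using lin[of b] by (auto simp: Vector_Spaces.linear_iff)
  \<comment> \<open>The finite set of relevant basis vectors depends on \<open>x\<close>. Allowing
    every finite superset makes expansions of different tensors comparable over a union, both in the
    additive case and for \<open>z\<close> and \<open>w\<close> at the end.\<close>
  have expand: "\<exists>F. finite F \<and> (\<forall>F'. finite F' \<and> F \<subseteq> F' \<longrightarrow> x = (\<Sum>b\<in>F'. tens b (h b x)))" for x
  proof (induction x rule: tensor_induct)
    case (tens u v)
    let ?F = "{b. \<alpha> b u \<noteq> 0}"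
    have fin: "finite ?F"
      unfolding \<alpha>_def by (rule U.finite_representation)
    have "tens u v = (\<Sum>b\<in>F. tens b (h b (tens u v)))" if "finite F" "?F \<subseteq> F" for F
    proof -
      have "u = (\<Sum>b\<in>?F. sU (\<alpha> b u) b)"
        unfolding \<alpha>_def using U.sum_nonzero_representation_eq[OF B(1), of u] B(2) by simp
      also have "\<dots> = (\<Sum>b\<in>F. sU (\<alpha> b u) b)"
        using that by (intro sum.mono_neutral_left) auto
      finally have "tens u v = tens (\<Sum>b\<in>F. sU (\<alpha> b u) b) v"
        by (rule arg_cong)
      also have "\<dots> = (\<Sum>b\<in>F. tens b (h b (tens u v)))"
        by (simp add: tens_sum_left h tens_simps)
      finally show ?thesis .
    qed
    with fin show ?case
      by blast
  next
    case (add x y)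
    then obtain F G where "finite F" "finite G"
      and F: "\<And>F'. finite F' \<Longrightarrow> F \<subseteq> F' \<Longrightarrow> x = (\<Sum>b\<in>F'. tens b (h b x))"
      and G: "\<And>F'. finite F' \<Longrightarrow> G \<subseteq> F' \<Longrightarrow> y = (\<Sum>b\<in>F'. tens b (h b y))"
      by metis
    have "x + y = (\<Sum>b\<in>F'. tens b (h b (x + y)))" if "finite F'" "F \<union> G \<subseteq> F'" for F'
      using F[of F'] G[of F'] that by (simp add: hs tens_simps sum.distrib)
    then show ?case
      using \<open>finite F\<close> \<open>finite G\<close> by (intro exI[of _ "F \<union> G"]) auto
  next
    case (scale c x)
    then obtain F where "finite F"
      and F: "\<And>F'. finite F' \<Longrightarrow> F \<subseteq> F' \<Longrightarrow> x = (\<Sum>b\<in>F'. tens b (h b x))"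
      by metis
    have "sT c x = (\<Sum>b\<in>F'. tens b (h b (sT c x)))" if "finite F'" "F \<subseteq> F'" for F'
      using F[OF that] by (simp add: hs tens_simps T.scale_sum_right[symmetric])
    then show ?case
      using \<open>finite F\<close> by blast
  qed
  obtain F G where "finite F" "finite G"
    and F: "\<And>F'. finite F' \<Longrightarrow> F \<subseteq> F' \<Longrightarrow> z = (\<Sum>b\<in>F'. tens b (h b z))"
    and G: "\<And>F'. finite F' \<Longrightarrow> G \<subseteq> F' \<Longrightarrow> w = (\<Sum>b\<in>F'. tens b (h b w))"
    using expand[of z] expand[of w] by metis
  have "z = (\<Sum>b\<in>F \<union> G. tens b (h b z))"
    by (rule F) (use \<open>finite F\<close> \<open>finite G\<close> in auto)
  also have "\<dots> = (\<Sum>b\<in>F \<union> G. tens b (h b w))"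
    using assms[OF \<alpha> lin h] by simp
  also have "\<dots> = w"
    by (rule G[symmetric]) (use \<open>finite F\<close> \<open>finite G\<close> in auto)
  finally show ?thesis .
qed

lemma tensor_End_unique:
  assumes "Vector_Spaces.linear sU sU f" "Vector_Spaces.linear sV sV \<phi>"
    and "Vector_Spaces.linear sT sT h" "\<And>u v. h (tens u v) = tens (f u) (\<phi> v)"
  shows "tensor_End sT tens f \<phi> = h"
  by (rule linear_eqI[of sT]) (use assms tensor_map in auto)

end

section \<open>Lie-centroids and the Lie-commutator ideal\<close>

lemma Lie_bracket_commute: "Lie_bracket bracket x y = Lie_bracket bracket y x"
  by (simp add: Lie_bracket_def add.commute)

text \<open>Symmetry of the Lie bracket turns each of the two defining identities into the other, so
  only one has to be checked.\<close>

lemma mem_Lie_centroid_iff: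
  "d \<in> Lie_centroid s bracket \<longleftrightarrow> Vector_Spaces.linear s s d \<and>
     (\<forall>x y. d (Lie_bracket bracket x y) = Lie_bracket bracket (d x) y)"
  unfolding Lie_centroid_def by (auto simp: Lie_bracket_commute) (metis Lie_bracket_commute)

lemma bilinear_map_Lie_bracket:
  assumes "bilinear_map s s s bracket"
  shows "bilinear_map s s s (Lie_bracket bracket)"
proof -
  interpret vector_space s
    using assms by (auto simp: bilinear_map_def Vector_Spaces.linear_iff)
  show ?thesis
    using assms
    by (auto simp: bilinear_map_def Vector_Spaces.linear_iff Lie_bracket_def scale_right_distrib
        algebra_simps)
qed

text \<open>If all Lie brackets vanished, the generating set would be \<open>{0}\<close>, which is
  already a two-sided ideal and so equals its hull.\<close>

lemma (in leibniz_algebra) gamma2_Lie_nontrivialE: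
  assumes "gamma2_Lie scale bracket \<noteq> {0}"
  obtains x y where "Lie_bracket bracket x y \<noteq> 0"
proof (rule ccontr)
  assume "\<not> thesis"
  with that have "Lie_bracket bracket x y = 0" for x y
    by blast
  then have "{Lie_bracket bracket x y | x y. True} = {0}"
    by simp
  moreover have "two_sided_ideal scale bracket {0}"
    using bilinear
    by (auto simp: two_sided_ideal_def bilinear_map_def intro: linear_zero')
  ultimately show False
    using assms by (simp add: gamma2_Lie_def hull_same)
qed

section \<open>The centroid of a unital commutative algebra\<close>

context unital_comm_algebra
begin

lemma scale_mult_right: "scale c (a * b) = a * scale c b"
  using scale_mult[of c b a] by (simp add: mult.commute)

lemma linear_mult_left: "Vector_Spaces.linear scale scale ((*) a)"
  by (simp add: Vector_Spaces.linear_iff vector_space_axioms distrib_left scale_mult_right)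

text \<open>A centroid element is determined by its value at the unit, since
  \<open>f (unit * b) = f unit * b\<close>.\<close>

lemma centroid_eq: "centroid scale = range (*)"
proof (intro set_eqI iffI)
  fix f
  assume f: "f \<in> centroid scale"
  have "f b = f unit * b" for b
  proof -
    have "f (unit * b) = f unit * b"
      using f by (simp add: centroid_def)
    then show ?thesis
      by (simp add: unit_mult)
  qed
  then have "f = (*) (f unit)"
    by (rule ext)
  then show "f \<in> range (*)"
    by (rule range_eqI)
next
  fix f
  assume "f \<in> range ((*) :: 'a \<Rightarrow> 'a \<Rightarrow> 'a)"
  then obtain a where "f = (*) a"
    by blast
  then show "f \<in> centroid scale"
    by (simp add: centroid_def linear_mult_left mult.assoc mult.left_commute)
qed

end

section \<open>Multiplication by elements of the algebra on the tensor product\<close>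

locale leibniz_tensor =
  A: unital_comm_algebra sA e + G: leibniz_algebra sG bracket + tensor_product sA sG sT tens
  for sA :: "'k::field \<Rightarrow> 'a::comm_ring \<Rightarrow> 'a" and e
    and sG :: "'k \<Rightarrow> 'g::ab_group_add \<Rightarrow> 'g" and bracket
    and sT :: "'k \<Rightarrow> 't::ab_group_add \<Rightarrow> 't" and tens
begin

abbreviation J where "J \<equiv> Lie_bracket bracket"
abbreviation JT where "JT \<equiv> Lie_bracket (tensor_bracket sT tens bracket)"

lemmas tensor_bracket_facts =
  tensor_bracket[OF A.unital_comm_algebra_axioms G.leibniz_algebra_axioms tensor_product_axioms]

lemma JT_tens: "JT (tens a x) (tens b y) = tens (a * b) (J x y)"
  by (simp add: Lie_bracket_def tensor_bracket_facts tens_simps mult.commute[of b a])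

lemma J_simps:
  "J (x + x') y = J x y + J x' y" "J x (y + y') = J x y + J x y'"
  "J (sG c x) y = sG c (J x y)" "J x (sG c y) = sG c (J x y)"
  using bilinear_map_Lie_bracket[OF G.bilinear]
  by (auto simp: bilinear_map_def Vector_Spaces.linear_iff)

lemma JT_simps:
  "JT (x + x') y = JT x y + JT x' y" "JT x (y + y') = JT x y + JT x y'"
  "JT (sT c x) y = sT c (JT x y)" "JT x (sT c y) = sT c (JT x y)"
  using bilinear_map_Lie_bracket[OF tensor_bracket_facts(1)]
  by (auto simp: bilinear_map_def Vector_Spaces.linear_iff)

text \<open>This is the action of \<open>A\<close> on its tensor product with the Leibniz algebra.
  As a function of \<open>a\<close> it becomes the isomorphism from \<open>A\<close> onto the
  Lie-centroid.\<close>

definition mult_End :: "'a \<Rightarrow> 't \<Rightarrow> 't" where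
  "mult_End a = tensor_End sT tens ((*) a) id"

lemma linear_mult_End: "Vector_Spaces.linear sT sT (mult_End a)"
  and mult_End_tens [simp]: "mult_End a (tens b x) = tens (a * b) x"
  unfolding mult_End_def
  using tensor_map[OF A.linear_mult_left G.linear_id] by simp_all

lemma mult_End_simps:
  "mult_End a (z + w) = mult_End a z + mult_End a w" "mult_End a (sT c z) = sT c (mult_End a z)"
  using linear_mult_End[of a] by (auto simp: Vector_Spaces.linear_iff)

lemma mult_End_add: "mult_End (a + b) = mult_End a + mult_End b"
proof
  show "mult_End (a + b) z = (mult_End a + mult_End b) z" for z
    by (induction z rule: tensor_induct)
      (simp_all add: mult_End_simps distrib_right tens_simps T.scale_right_distrib)
qed

lemma mult_End_scale: "mult_End (sA c a) = End_scale sT c (mult_End a)"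
proof
  show "mult_End (sA c a) z = End_scale sT c (mult_End a) z" for z
    by (induction z rule: tensor_induct)
      (simp_all add: End_scale_def mult_End_simps A.scale_mult[symmetric] tens_simps
        T.scale_right_distrib)
qed

lemma mult_End_mult: "mult_End (a * b) = mult_End a \<circ> mult_End b"
proof
  show "mult_End (a * b) z = (mult_End a \<circ> mult_End b) z" for z
    by (induction z rule: tensor_induct) (simp_all add: mult_End_simps mult.assoc)
qed

lemma mult_End_unit: "mult_End e = id"
proof
  show "mult_End e z = id z" for z
    by (induction z rule: tensor_induct) (simp_all add: mult_End_simps A.unit_mult)
qed

lemma linear_mult_End_map: "Vector_Spaces.linear sA (End_scale sT) mult_End"
  using vector_space_End_scale[OF T.vector_space_axioms]
  by (simp add: Vector_Spaces.linear_iff A.vector_space_axioms mult_End_add mult_End_scale)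

text \<open>Evaluation at \<open>tens e x\<close> gives \<open>tens a x\<close>, from which the
  nonzero \<open>x\<close> can be cancelled.\<close>

lemma inj_mult_End:
  fixes x :: 'g
  assumes "x \<noteq> 0"
  shows "inj mult_End"
proof (rule injI)
  fix a b
  assume "mult_End a = mult_End b"
  then have "mult_End a (tens e x) = mult_End b (tens e x)"
    by simp
  then have "tens a x = tens b x"
    by (simp add: mult.commute[of _ e] A.unit_mult)
  then show "a = b"
    by (rule tens_left_cancel[OF assms])
qed

text \<open>On pure tensors this is associativity in \<open>A\<close>; bilinearity extends it first
  in the second argument, then in the first.\<close>

lemma mult_End_in_Lie_centroid: "mult_End a \<in> Lie_centroid sT (tensor_bracket sT tens bracket)"
proof -
  have "mult_End a (JT (tens b x) w) = JT (mult_End a (tens b x)) w" for b x w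
    by (induction w rule: tensor_induct) (simp_all add: JT_simps JT_tens mult_End_simps mult.assoc)
  then have "mult_End a (JT z w) = JT (mult_End a z) w" for z w
    by (induction z rule: tensor_induct) (simp_all add: JT_simps mult_End_simps del: mult_End_tens)
  then show ?thesis
    by (simp add: mem_Lie_centroid_iff linear_mult_End)
qed

text \<open>Multiplication by \<open>a\<close> tensored with the scalar \<open>c\<close> is
  \<open>mult_End (sA c a)\<close>. The generators therefore already form a subspace, and taking the
  span adds nothing.\<close>

lemma tensor_End_span_scalars:
  "tensor_End_span sT tens (centroid sA) {End_scale sG c id | c. True} = range mult_End"
proof -
  interpret E: vector_space "End_scale sT"
    by (rule vector_space_End_scale[OF T.vector_space_axioms])
  have sc: "tensor_End sT tens ((*) a) (End_scale sG c id) = mult_End (sA c a)" for a c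
    by (rule tensor_End_unique[OF A.linear_mult_left _ linear_mult_End])
      (simp_all add: End_scale_def G.linear_scale_self A.scale_mult[symmetric] tens_simps)
  have id: "End_scale sG 1 id = id"
    by (simp add: End_scale_def fun_eq_iff)
  have "{tensor_End sT tens f \<phi> | f \<phi>. f \<in> centroid sA \<and> \<phi> \<in> {End_scale sG c id | c. True}}
      = range mult_End" (is "?L = _")
  proof
    show "?L \<subseteq> range mult_End"
      by (auto simp: A.centroid_eq sc)
    show "range mult_End \<subseteq> ?L"
    proof
      fix h
      assume "h \<in> range mult_End"
      then obtain a where "h = tensor_End sT tens ((*) a) (End_scale sG 1 id)"
        by (auto simp: mult_End_def id)
      then show "h \<in> ?L"
        by (auto simp: A.centroid_eq)
    qed
  qed
  moreover have "E.subspace (range mult_End)"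
  proof -
    have "0 = mult_End 0"
      using mult_End_add[of 0 0] by simp
    then show ?thesis
      by (auto simp: E.subspace_def mult_End_add[symmetric] mult_End_scale[symmetric])
  qed
  ultimately show ?thesis
    by (simp add: tensor_End_span_def)
qed

text \<open>Because \<open>e\<close> is the unit, contraction commutes with bracketing by
  \<open>tens e y\<close>: \<open>h (JT z (tens e y)) = J (h z) y\<close>. The centroid identity of
  \<open>d\<close> in its first argument then descends to the contraction.\<close>

lemma contraction_in_Lie_centroid:
  assumes d: "d \<in> Lie_centroid sT (tensor_bracket sT tens bracket)"
    and h: "Vector_Spaces.linear sT sG h" "\<And>a x. h (tens a x) = sG (\<alpha> a) x"
  shows "(\<lambda>x. h (d (tens a x))) \<in> Lie_centroid sG bracket"
proof -
  have lin: "Vector_Spaces.linear sT sT d" and dJ: "d (JT z w) = JT (d z) w" for z w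
    using d by (auto simp: mem_Lie_centroid_iff)
  have hJ: "h (JT z (tens e y)) = J (h z) y" for z y
    by (induction z rule: tensor_induct)
      (use h in \<open>simp_all add: JT_tens JT_simps J_simps Vector_Spaces.linear_iff
        mult.commute[of _ e] A.unit_mult\<close>)
  have "h (d (tens a (J x y))) = J (h (d (tens a x))) y" for x y
    using hJ[of "d (tens a x)" y]
    by (simp add: dJ[symmetric] JT_tens mult.commute[of _ e] A.unit_mult)
  moreover have "Vector_Spaces.linear sG sG (\<lambda>x. h (d (tens a x)))"
    using h(1) lin by (simp add: Vector_Spaces.linear_iff tens_simps)
  ultimately show ?thesis
    by (simp add: mem_Lie_centroid_iff)
qed

lemma Lie_centroid_tensor_eq:
  assumes central: "Lie_centroid sG bracket = {End_scale sG c id | c. True}"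
    and nz: "J x0 y0 \<noteq> 0"
  shows "Lie_centroid sT (tensor_bracket sT tens bracket) = range mult_End"
proof
  show "range mult_End \<subseteq> Lie_centroid sT (tensor_bracket sT tens bracket)"
    using mult_End_in_Lie_centroid by auto
  show "Lie_centroid sT (tensor_bracket sT tens bracket) \<subseteq> range mult_End"
  proof
    fix d
    assume d: "d \<in> Lie_centroid sT (tensor_bracket sT tens bracket)"
    then have lin: "Vector_Spaces.linear sT sT d" and dJ: "d (JT z w) = JT (d z) w" for z w
      by (auto simp: mem_Lie_centroid_iff)
    obtain \<phi> where \<phi>: "Vector_Spaces.linear sG (*) \<phi>" "\<phi> (J x0 y0) = 1"
      using G.functional_eq_1_exists[OF nz] .
    obtain k where k: "Vector_Spaces.linear sT sA k" "\<And>a x. k (tens a x) = sA (\<phi> x) a"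
      using contract_right[OF \<phi>(1)] by blast
    \<comment> \<open>If \<open>d (tens a x)\<close> is to be \<open>tens (\<rho> a) x\<close>,
      contracting the right factor at \<open>x = J x0 y0\<close>, where \<open>\<phi>\<close> is 1,
      must return \<open>\<rho> a\<close>.\<close>
    define \<rho> where "\<rho> a = k (d (tens a (J x0 y0)))" for a
    have d_tens: "d (tens a x) = tens (\<rho> a) x" for a x
    proof (rule eq_if_contractions_eq)
      fix \<alpha> h
      assume \<alpha>: "Vector_Spaces.linear sA (*) \<alpha>"
        and h: "Vector_Spaces.linear sT sG h" "\<And>a x. h (tens a x) = sG (\<alpha> a) x"
      obtain c where "(\<lambda>x. h (d (tens a x))) = End_scale sG c id"
        using contraction_in_Lie_centroid[OF d h, of a] central by auto
      then have c: "h (d (tens a x)) = sG c x" for x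
        by (simp add: End_scale_def fun_eq_iff)
      \<comment> \<open>Contracting both factors gives the same scalar in either order. This
        identifies \<open>c\<close>, which depends on \<open>\<alpha>\<close> and \<open>a\<close>,
        as \<open>\<alpha> (\<rho> a)\<close> with \<open>\<rho>\<close> independent of
        \<open>\<alpha>\<close>.\<close>
      have "\<phi> (h z) = \<alpha> (k z)" for z
        by (induction z rule: tensor_induct)
          (use \<alpha> \<phi>(1) h k in \<open>simp_all add: Vector_Spaces.linear_iff mult.commute\<close>)
      from this[of "d (tens a (J x0 y0))"] have "\<alpha> (\<rho> a) = c"
        using \<phi> by (simp add: c \<rho>_def Vector_Spaces.linear_iff)
      then show "h (d (tens a x)) = h (tens (\<rho> a) x)"
        by (simp add: c h)
    qed
    have \<rho>: "\<rho> a = \<rho> e * a" for a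
    proof (rule tens_left_cancel[OF nz])
      \<comment> \<open>The bracket of \<open>tens e x0\<close> and \<open>tens a y0\<close> is
        \<open>tens a (J x0 y0)\<close>; \<open>d\<close> acts either on this value or on the first
        argument.\<close>
      show "tens (\<rho> a) (J x0 y0) = tens (\<rho> e * a) (J x0 y0)"
        using dJ[of "tens e x0" "tens a y0"] by (simp add: JT_tens d_tens A.unit_mult)
    qed
    have "d (tens a x) = mult_End (\<rho> e) (tens a x)" for a x
      by (simp only: d_tens mult_End_tens \<rho>[of a])
    then have "d = mult_End (\<rho> e)"
      by (intro linear_eqI[OF lin linear_mult_End])
    then show "d \<in> range mult_End"
      by simp
  qed
qed

end

theorem theorem6p5:
  fixes scaleA :: "'k::{alg_closed_field, field_char_0} \<Rightarrow> 'a::comm_ring \<Rightarrow> 'a"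
    and unitA :: 'a
    and scaleG :: "'k \<Rightarrow> 'g::ab_group_add \<Rightarrow> 'g"
    and bracketG :: "'g \<Rightarrow> 'g \<Rightarrow> 'g"
    and scaleT :: "'k \<Rightarrow> 't::ab_group_add \<Rightarrow> 't"
    and tens :: "'a \<Rightarrow> 'g \<Rightarrow> 't"
  assumes "unital_comm_algebra scaleA unitA"
    and "leibniz_algebra scaleG bracketG"
    and "tensor_product scaleA scaleG scaleT tens"
    and "gamma2_Lie scaleG bracketG \<noteq> {0}"
    and "Lie_centroid scaleG bracketG = {End_scale scaleG c id | c. True}"
  shows "Lie_centroid scaleT (tensor_bracket scaleT tens bracketG) =
           tensor_End_span scaleT tens (centroid scaleA) (Lie_centroid scaleG bracketG) \<and>
         (\<exists>\<Phi>. Vector_Spaces.linear scaleA (End_scale scaleT) \<Phi> \<and>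
             (\<forall>a b. \<Phi> (a * b) = \<Phi> a \<circ> \<Phi> b) \<and> \<Phi> unitA = id \<and>
             bij_betw \<Phi> UNIV
               (tensor_End_span scaleT tens (centroid scaleA) (Lie_centroid scaleG bracketG)))"
proof -
  interpret A: unital_comm_algebra scaleA unitA by fact
  interpret G: leibniz_algebra scaleG bracketG by fact
  interpret tensor_product scaleA scaleG scaleT tens by fact
  interpret leibniz_tensor scaleA unitA scaleG bracketG scaleT tens ..
  \<comment> \<open>This nonzero bracket serves twice: it fixes the multiplier of a Lie-centroid
    element, and it is a nonzero vector witnessing injectivity of \<open>mult_End\<close>.\<close>
  obtain x y where xy: "Lie_bracket bracketG x y \<noteq> 0"
    using G.gamma2_Lie_nontrivialE[OF assms(4)] .
  have span: "tensor_End_span scaleT tens (centroid scaleA) (Lie_centroid scaleG bracketG)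
      = range mult_End"
    unfolding assms(5) by (rule tensor_End_span_scalars)
  \<comment> \<open>With both sides equal to \<open>range mult_End\<close>, the witness for
    \<open>\<Phi>\<close> is \<open>mult_End\<close>, which is onto by construction.\<close>
  show ?thesis
    unfolding span
    using Lie_centroid_tensor_eq[OF assms(5) xy] linear_mult_End_map mult_End_mult mult_End_unit
      inj_mult_End[OF xy]
    by (auto simp: bij_betw_def intro!: exI[of _ mult_End])
qed

end
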